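(* Let $p$ be a prime number and let $F(x)\in\mathbb{F}_p[[x]]$ satisfy $$A(x)+B(x)F(x)+C(x)F(x)^2=0,$$ where $A,B,C\in\mathbb{F}_p[x]$ satisfy one of the following conditions: (i) $B(0)=1$, $C(0)=0$, $C(x)\neq0$; (ii) $B(0)=1$, $C(x)=0$; (iii) $B(0)=1$, $C(0)\neq0$, $A(0)=0$; (iv) $p\neq2$, $B(x)=0$, $C(0)=1$, and $A(x)=-(a_kx^k)^2+O(x^{2k+1})$ for some $k\in\mathbb{N}$ and some $a_k\neq0$. Then the super $1$-fraction expansion of $F(x)$ exists and is ultimately periodic.
   Context: A super $1$-fraction is a continued fraction $$\cfrac{v_0x^{k_0}}{1+u_1(x)x-\cfrac{v_1x^{k_0+k_1+1}}{1+u_2(x)x-\cfrac{v_2x^{k_1+k_2+1}}{1+u_3(x)x-\cdots}}}$$ with nonzero constants $v_j\in\mathbb{F}_p$, nonnegative integers $k_j$, and polynomials $u_j(x)$ of degree at most $k_{j-1}-1$ (the zero polynomial has degree $-1$); the expansion may terminate after finitely many levels (the zero series has the empty expansion). It is ultimately periodic if the sequence $(v_j,k_j,u_{j+1}(x))_{j\ge0}$ is ultimately periodic; a terminating expansion is regarded as ultimately periodic. *)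

theory Defs
  imports
    "HOL-Computational_Algebra.Polynomial_FPS"
    "Berlekamp_Zassenhaus.Finite_Field"
begin

text \<open>
  The level with index \<open>j\<close> of a super 1-fraction is the triple \<open>(v\<^sub>j, k\<^sub>j, u\<^sub>j\<^sub>+\<^sub>1)\<close>.
\<close>

type_synonym 'a level = "'a \<times> nat \<times> 'a poly"

text \<open>
  The bound \<open>deg u\<^sub>j\<^sub>+\<^sub>1 \<le> k\<^sub>j - 1\<close> uses the convention that the zero polynomial has degree \<open>-1\<close>,
  whereas \<^term>\<open>degree 0 = 0\<close> in the library; in particular \<open>k\<^sub>j = 0\<close> forces \<open>u\<^sub>j\<^sub>+\<^sub>1 = 0\<close>.
\<close>

definition valid_level :: "'a::field level \<Rightarrow> bool" where
  "valid_level l \<longleftrightarrow> (case l of (v, k, u) \<Rightarrow> v \<noteq> 0 \<and> (u = 0 \<or> degree u < k))"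

datatype 'l expansion =
    Terminating "'l list"
  | Infinite "nat \<Rightarrow> 'l"

text \<open>
  The first argument is the part of the exponent of \<open>x\<close> in the topmost numerator that is
  inherited from the level above: \<open>0\<close> at the outermost level and \<open>k\<^sub>j\<^sub>-\<^sub>1 + 1\<close> at level \<open>j \<ge> 1\<close>.
\<close>

fun frac_from :: "nat \<Rightarrow> 'a::field level list \<Rightarrow> 'a fps" where
  "frac_from d [] = 0"
| "frac_from d ((v, k, u) # ls) =
     (fps_const v * fps_X ^ (d + k)) / (1 + fps_of_poly u * fps_X - frac_from (k + 1) ls)"

definition finite_frac :: "'a::field level list \<Rightarrow> 'a fps" where
  "finite_frac ls = frac_from 0 ls"

text \<open>
  An infinite fraction represents the limit of its convergents for the \<open>x\<close>-adic metric, which is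
  the library's metric on formal power series.
\<close>

fun super1_expansion :: "'a::field fps \<Rightarrow> 'a level expansion \<Rightarrow> bool" where
  "super1_expansion F (Terminating ls) \<longleftrightarrow>
     (\<forall>l \<in> set ls. valid_level l) \<and> F = finite_frac ls"
| "super1_expansion F (Infinite s) \<longleftrightarrow>
     (\<forall>j. valid_level (s j)) \<and> (\<lambda>n. finite_frac (map s [0..<n])) \<longlonglongrightarrow> F"

fun ultimately_periodic :: "'l expansion \<Rightarrow> bool" where
  "ultimately_periodic (Terminating ls) \<longleftrightarrow> True"
| "ultimately_periodic (Infinite s) \<longleftrightarrow> (\<exists>m T. T > 0 \<and> (\<forall>j\<ge>m. s (j + T) = s j))"

end

theory Submission
  imports Defs
begin

text \<open>
  Every nonzero series is uniquely \<open>F = v x\<^sup>k / (D - x\<^bsup>k+1\<^esup> G)\<close> with \<open>D = 1 + u x\<close> of degree at most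
  \<open>k\<close>, so the levels of an expansion are determined by its successive tails \<open>G\<close>, and the expansion
  is ultimately periodic as soon as the tails take finitely many values. If \<open>A + B F + C F\<^sup>2 = 0\<close> and
  \<open>B + 2 C F\<close> does not vanish at \<open>0\<close>, then \<open>A = x\<^sup>k A'\<close>, and substituting and cancelling
  \<open>x\<^bsup>2k+1\<^esup>\<close> gives \<open>A\<^sub>1 + B\<^sub>1 G + C\<^sub>1 G\<^sup>2 = 0\<close> with \<open>B\<^sub>1 = - (2 A' D + v B)\<close>, \<open>C\<^sub>1 = x A\<close> and
  \<open>A\<^sub>1 = (A D\<^sup>2 + v B x\<^sup>k D + v\<^sup>2 C x\<^bsup>2k\<^esup>) / x\<^bsup>2k+1\<^esup>\<close>. The bounds \<open>deg A < M\<close>, \<open>deg B \<le> M\<close>,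
  \<open>deg C \<le> M\<close> and the nonvanishing at \<open>0\<close> are preserved, so over a finite field only finitely many
  equations, hence finitely many tails, occur. In cases (i)--(iii) the nonvanishing holds for \<open>F\<close>
  itself; in case (iv) it holds from the first tail on, after cancelling a further \<open>x\<^sup>k\<close>.
\<close>

unbundle fps_syntax

section \<open>Divisibility by powers of \<open>x\<close> and polynomials of bounded degree\<close>

lemma fps_X_power_dvd_iff: "fps_X ^ n dvd (f :: 'a::field fps) \<longleftrightarrow> (\<forall>i<n. f $ i = 0)"
proof
  assume "fps_X ^ n dvd f"
  then show "\<forall>i<n. f $ i = 0"
    by (auto simp: fps_X_power_mult_nth elim!: dvdE)
next
  assume "\<forall>i<n. f $ i = 0"
  then have "f = fps_X ^ n * fps_shift n f"
    by (auto simp: fps_eq_iff fps_X_power_mult_nth)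
  then show "fps_X ^ n dvd f"
    by (rule dvdI)
qed

lemma finite_poly_degree_le: "finite {p :: 'a::{comm_monoid_add, finite} poly. degree p \<le> n}"
proof (rule inj_on_finite)
  let ?f = "\<lambda>p :: 'a poly. map (Polynomial.coeff p) [0..<Suc n]"
  show "inj_on ?f {p. degree p \<le> n}"
  proof (rule inj_onI, rule poly_eqI)
    fix p q :: "'a poly" and i
    assume "p \<in> {p. degree p \<le> n}" "q \<in> {p. degree p \<le> n}" "?f p = ?f q"
    then show "Polynomial.coeff p i = Polynomial.coeff q i"
      by (cases "i \<le> n") (auto simp: coeff_eq_0 simp del: upt_Suc)
  qed
  show "?f ` {p. degree p \<le> n} \<subseteq> {xs. set xs \<subseteq> UNIV \<and> length xs = Suc n}"
    by auto
  show "finite {xs :: 'a list. set xs \<subseteq> UNIV \<and> length xs = Suc n}"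
    by (rule finite_lists_length_eq) simp
qed

text \<open>Clears a power of \<open>x\<close> from an equation while keeping its free term a
  polynomial: the other summand is divisible by \<open>x^e\<close>, so the polynomial is
  too.\<close>

lemma fps_of_poly_cancel_X_power:
  fixes A :: "'a::field poly"
  assumes "fps_of_poly A + fps_X ^ e * H = 0"
  obtains A' where "A = Polynomial.monom 1 e * A'" "fps_of_poly A' + H = 0"
proof -
  have "fps_of_poly A = fps_X ^ e * (- H)"
    using assms by (simp add: eq_neg_iff_add_eq_0)
  then have "fps_X ^ e dvd fps_of_poly A"
    by (metis dvd_triv_left)
  then have "Polynomial.monom 1 e dvd A"
    by (simp add: fps_X_power_dvd_iff monom_1_dvd_iff')
  then obtain A' where A': "A = Polynomial.monom 1 e * A'"
    by (elim dvdE)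
  have "fps_X ^ e * (fps_of_poly A' + H) = 0"
    using assms by (simp add: A' fps_of_poly_mult fps_of_poly_monom' distrib_left)
  then show thesis
    using A' that by simp
qed

subsection \<open>One level of a super 1-fraction\<close>

text \<open>The factor \<open>x^(k+1)\<close> that the next numerator inherits is split off, so the
  tail \<open>G\<close> is again a fraction with nothing inherited and all levels act alike.\<close>

definition denominator :: "nat \<Rightarrow> 'a::field poly \<Rightarrow> 'a fps \<Rightarrow> 'a fps" where
  "denominator k u G = 1 + fps_of_poly u * fps_X - fps_X ^ (k + 1) * G"

fun cf_step :: "'a::field level \<Rightarrow> 'a fps \<Rightarrow> 'a fps" where
  "cf_step (v, k, u) G = fps_const v * fps_X ^ k / denominator k u G"

declare cf_step.simps [simp del]

lemma denominator_nth_0 [simp]: "denominator k u G $ 0 = 1"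
  by (simp add: denominator_def)

text \<open>The degree bound keeps \<open>u\<close> and \<open>G\<close> apart: \<open>u\<close>
  fills the coefficients of index 1 to \<open>k\<close>, and \<open>-G\<close> those from
  \<open>k + 1\<close> on.\<close>

lemma denominator_nth_Suc:
  assumes "u = 0 \<or> degree u < k"
  shows "denominator k u G $ Suc i = (if i < k then Polynomial.coeff u i else - G $ (i - k))"
  using assms by (auto simp: denominator_def fps_X_power_mult_nth coeff_eq_0 simp del: power_Suc)

lemma denominator_inject:
  assumes "u = 0 \<or> degree u < k" "u' = 0 \<or> degree u' < k"
    and "denominator k u G = denominator k u' G'"
  shows "u = u' \<and> G = G'"
proof
  have eq: "(if i < k then Polynomial.coeff u i else - G $ (i - k))
      = (if i < k then Polynomial.coeff u' i else - G' $ (i - k))" for i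
    using assms denominator_nth_Suc by metis
  show "u = u'"
  proof (rule poly_eqI)
    fix i show "Polynomial.coeff u i = Polynomial.coeff u' i"
      using eq[of i] assms(1,2) by (cases "i < k") (auto simp: coeff_eq_0)
  qed
  show "G = G'"
  proof (rule fps_ext)
    fix i show "G $ i = G' $ i"
      using eq[of "i + k"] by simp
  qed
qed

lemma cf_step_altdef:
  "cf_step (v, k, u) G = fps_const v * fps_X ^ k * inverse (denominator k u G)"
  by (simp add: cf_step.simps fps_divide_unit)

lemma cf_step_mult_denominator:
  "cf_step (v, k, u) G * denominator k u G = fps_const v * fps_X ^ k"
  by (simp add: cf_step_altdef mult.assoc inverse_mult_eq_1)

lemma cf_step_eq_X_power_mult:
  obtains W where "cf_step (v, k, u) G = fps_X ^ k * W" "W $ 0 = v"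
  by (rule that[of "fps_const v * inverse (denominator k u G)"])
     (simp_all add: cf_step_altdef mult_ac)

lemma cf_step_nonzero: "v \<noteq> 0 \<Longrightarrow> cf_step (v, k, u) G \<noteq> 0"
  using cf_step_mult_denominator[of v k u G] by auto

lemma subdegree_cf_step: "v \<noteq> 0 \<Longrightarrow> subdegree (cf_step (v, k, u) G) = k"
  by (rule cf_step_eq_X_power_mult[of v k u G])
     (auto simp: fps_X_power_mult_nth intro: subdegreeI)

lemma cf_step_nth: "cf_step (v, k, u) G $ k = v"
  by (rule cf_step_eq_X_power_mult[of v k u G])
     (simp add: fps_X_power_mult_nth)

text \<open>The value \<open>F\<close> of a step has order \<open>k\<close> and coefficient
  \<open>v\<close> there; cancelling the nonzero \<open>F\<close> in
  \<open>F * denominator k u G = v x^k\<close> then fixes the denominator, hence \<open>u\<close>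
  and \<open>G\<close>.\<close>

lemma cf_step_inject:
  assumes "valid_level l" "valid_level l'" "cf_step l G = cf_step l' G'"
  shows "l = l' \<and> G = G'"
proof -
  obtain v k u v' k' u' where l: "l = (v, k, u)" "l' = (v', k', u')"
    by (metis prod.exhaust)
  have valid: "v \<noteq> 0" "u = 0 \<or> degree u < k" "v' \<noteq> 0" "u' = 0 \<or> degree u' < k'"
    using assms(1,2) by (auto simp: l valid_level_def)
  have k: "k' = k"
    using assms(3) valid subdegree_cf_step l by metis
  have v: "v' = v"
    using assms(3) cf_step_nth l k by metis
  have "cf_step l G * denominator k u G = cf_step l G * denominator k u' G'"
    using cf_step_mult_denominator assms(3) l k v by metis
  then have "denominator k u G = denominator k u' G'"
    using cf_step_nonzero[OF valid(1)] by (simp add: l)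
  then show ?thesis
    using denominator_inject valid l k v by blast
qed

lemma ex_cf_step:
  fixes F :: "'a::field fps"
  assumes "F \<noteq> 0"
  shows "\<exists>l G. valid_level l \<and> F = cf_step l G"
proof -
  define k v W where "k = subdegree F" and "v = F $ k" and "W = fps_shift k F"
  \<comment> \<open>\<open>R\<close> is the only possible denominator; it is cut after index
    \<open>k\<close> into \<open>u\<close> and \<open>-G\<close>. For \<open>k = 0\<close> the
    truncation is the zero polynomial, as the degree convention demands.\<close>
  define R where "R = fps_const v * inverse W"
  define u where "u = truncate_fps k (fps_shift 1 R)"
  define G where "G = - fps_shift (k + 1) R"
  have v: "v \<noteq> 0"
    using assms by (simp add: v_def k_def)
  have W0: "W $ 0 = v"
    by (simp add: W_def v_def)
  have F: "F = W * fps_X ^ k"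
    unfolding W_def k_def by (rule subdegree_decompose)
  have u: "u = 0 \<or> degree u < k"
    by (cases "k = 0") (auto simp: u_def degree_truncate_fps)
  have "denominator k u G = R"
  proof (rule fps_ext)
    fix n show "denominator k u G $ n = R $ n"
    proof (cases n)
      case 0
      then show ?thesis
        using v by (simp add: R_def W0)
    next
      case (Suc i)
      then show ?thesis
        by (simp add: denominator_nth_Suc[OF u]) (simp add: u_def G_def coeff_truncate_fps)
    qed
  qed
  moreover have "W * R = fps_const v"
    using inverse_mult_eq_1'[of W] W0 v by (simp add: R_def mult.left_commute)
  ultimately have "F * denominator k u G = fps_const v * fps_X ^ k"
    by (simp add: F mult_ac)
  then have "F * denominator k u G = cf_step (v, k, u) G * denominator k u G"
    by (simp only: cf_step_mult_denominator)
  moreover have "denominator k u G \<noteq> 0"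
    using denominator_nth_0[of k u G] by (metis fps_zero_nth zero_neq_one)
  ultimately have "F = cf_step (v, k, u) G"
    by simp
  moreover have "valid_level (v, k, u)"
    using v u by (simp add: valid_level_def)
  ultimately show ?thesis
    by blast
qed

text \<open>The difference of the reciprocals of two denominators is \<open>x^(k+1) (G - H)\<close>
  times a power series, so even for \<open>k = 0\<close> a factor \<open>x\<close> is
  gained.\<close>

lemma cf_step_contraction:
  assumes "fps_X ^ n dvd G - H"
  shows "fps_X ^ Suc n dvd cf_step l G - cf_step l H"
proof -
  obtain v k u where l: "l = (v, k, u)"
    by (metis prod.exhaust)
  let ?g = "denominator k u G" and ?h = "denominator k u H"
  have inv: "?g * inverse ?g = 1" "?h * inverse ?h = 1"
    by (simp_all add: inverse_mult_eq_1')
  have "inverse ?g * inverse ?h * (?h - ?g)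
      = inverse ?g * (?h * inverse ?h) - inverse ?h * (?g * inverse ?g)"
    by (simp only: algebra_simps)
  then have "inverse ?g - inverse ?h = inverse ?g * inverse ?h * (?h - ?g)"
    by (simp only: inv mult_1_right)
  also have "?h - ?g = fps_X * fps_X ^ k * (G - H)"
    by (simp add: denominator_def algebra_simps)
  finally have "cf_step l G - cf_step l H
      = (fps_const v * fps_X ^ k * inverse ?g * inverse ?h * fps_X ^ k) * (fps_X * (G - H))"
    unfolding l cf_step_altdef right_diff_distrib[symmetric] by (simp add: mult_ac)
  moreover have "fps_X ^ Suc n dvd fps_X * (G - H)"
    using assms by (simp add: mult_dvd_mono)
  ultimately show ?thesis
    by (metis dvd_mult)
qed

lemma foldr_cf_step_contraction:
  "fps_X ^ length ls dvd foldr cf_step ls G - foldr cf_step ls H"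
  by (induction ls) (auto intro: cf_step_contraction simp del: power_Suc)

text \<open>The inherited exponent only contributes a factor \<open>x^d\<close>, which turns the
  fraction into a fold of steps started at the zero tail.\<close>

lemma frac_from_eq: "frac_from d ls = fps_X ^ d * foldr cf_step ls 0"
proof (induction ls arbitrary: d)
  case (Cons l ls)
  obtain v k u where l: "l = (v, k, u)"
    by (metis prod.exhaust)
  have "1 + fps_of_poly u * fps_X - frac_from (k + 1) ls = denominator k u (foldr cf_step ls 0)"
    by (simp only: Cons.IH denominator_def)
  then show ?case
    by (simp add: l cf_step_altdef fps_divide_unit power_add mult_ac)
qed simp

lemma finite_frac_eq_foldr: "finite_frac ls = foldr cf_step ls 0"
  by (simp add: finite_frac_def frac_from_eq)

subsection \<open>Tails of an infinite expansion\<close>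

lemma foldr_cf_step_tails:
  assumes "\<And>n. n < m \<Longrightarrow> T n = cf_step (s n) (T (Suc n))"
  shows "T 0 = foldr cf_step (map s [0..<m]) (T m)"
  using assms
proof (induction m)
  case (Suc m)
  then have "T 0 = foldr cf_step (map s [0..<m]) (T m)"
    by simp
  also have "T m = cf_step (s m) (T (Suc m))"
    by (rule Suc.prems) simp
  finally show ?case
    by simp
qed simp

text \<open>\<open>T 0\<close> and the \<open>n\<close>-th convergent are the same \<open>n\<close>
  steps applied to \<open>T n\<close> and to 0, so by contraction they agree below index
  \<open>n\<close>.\<close>

lemma tails_tendsto:
  assumes "\<And>n. T n = cf_step (s n) (T (Suc n))"
  shows "(\<lambda>n. finite_frac (map s [0..<n])) \<longlonglongrightarrow> T 0"
proof (rule tendsto_fpsI)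
  fix i
  have "finite_frac (map s [0..<n]) $ i = T 0 $ i" if "n > i" for n
    using foldr_cf_step_contraction[of "map s [0..<n]" "T n" 0] that
    by (simp add: foldr_cf_step_tails[of n T s, OF assms, symmetric]
        finite_frac_eq_foldr fps_X_power_dvd_iff)
  then show "\<forall>\<^sub>F n in sequentially. finite_frac (map s [0..<n]) $ i = T 0 $ i"
    by (rule eventually_mono[OF eventually_gt_at_top])
qed

text \<open>Recovers tails when only the levels are given: the tail at \<open>m\<close> is the limit
  of the convergents of the sequence shifted by \<open>m\<close>. Uniqueness of limits identifies
  \<open>T 0\<close> with \<open>F\<close>.\<close>

lemma ex_tails:
  assumes "(\<lambda>n. finite_frac (map s [0..<n])) \<longlonglongrightarrow> F"
  shows "\<exists>T. T 0 = F \<and> (\<forall>n. T n = cf_step (s n) (T (Suc n)))"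
proof -
  define c where "c = (\<lambda>m n. foldr cf_step (map s [m..<m + n]) 0)"
  \<comment> \<open>Coefficient \<open>i\<close> no longer changes once \<open>i + 1\<close> levels
    are used, so it is read off there.\<close>
  define T where "T = (\<lambda>m. Abs_fps (\<lambda>i. c m (Suc i) $ i))"
  have T: "fps_X ^ n dvd T m - c m n" for m n
    unfolding fps_X_power_dvd_iff
  proof (intro allI impI)
    fix i assume "i < n"
    then obtain d where n: "n = Suc i + d"
      using less_iff_Suc_add by auto
    have "[m..<m + n] = [m..<m + Suc i] @ [m + Suc i..<m + Suc i + d]"
      unfolding n add.assoc[symmetric] by (rule upt_add_eq_append) simp
    then have "fps_X ^ Suc i dvd c m n - c m (Suc i)"
      using foldr_cf_step_contraction[of "map s [m..<m + Suc i]"] by (simp add: c_def del: upt_Suc power_Suc)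
    then show "(T m - c m n) $ i = 0"
      by (simp add: fps_X_power_dvd_iff T_def del: power_Suc)
  qed
  have step: "T m = cf_step (s m) (T (Suc m))" for m
  proof -
    \<comment> \<open>Both series agree with the convergent \<open>c m (Suc n)\<close> modulo
      \<open>x^(n+1)\<close>; as \<open>n\<close> is arbitrary, they are equal.\<close>
    have "fps_X ^ Suc n dvd T m - cf_step (s m) (T (Suc m))" for n
    proof -
      have "c m (Suc n) = cf_step (s m) (c (Suc m) n)"
        by (simp add: c_def upt_rec del: upt_Suc)
      moreover have "fps_X ^ Suc n dvd cf_step (s m) (T (Suc m)) - cf_step (s m) (c (Suc m) n)"
        by (intro cf_step_contraction T)
      ultimately show ?thesis
        using dvd_diff[OF T[of "Suc n" m]] by fastforce
    qed
    then have "T m - cf_step (s m) (T (Suc m)) = 0"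
      by (intro fps_ext) (auto simp: fps_X_power_dvd_iff simp del: power_Suc)
    then show ?thesis
      by simp
  qed
  have "T 0 = F"
    using LIMSEQ_unique[OF tails_tendsto[of T s, OF step] assms] .
  then show ?thesis
    using step by blast
qed

text \<open>Levels are split off by \<open>ex_cf_step\<close>: either a first zero tail ends the
  expansion, or the process never stops and its convergents tend to \<open>F\<close>.\<close>

lemma ex_super1_expansion: "\<exists>E. super1_expansion F E"
proof -
  define l where "l = (\<lambda>F :: 'a fps. SOME l. valid_level l \<and> (\<exists>G. F = cf_step l G))"
  define nxt where "nxt = (\<lambda>F. SOME G. F = cf_step (l F) G)"
  have l: "valid_level (l F) \<and> (\<exists>G. F = cf_step (l F) G)" if "F \<noteq> 0" for F
    unfolding l_def by (rule someI_ex) (use ex_cf_step that in blast)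
  have F_eq: "F = cf_step (l F) (nxt F)" if "F \<noteq> 0" for F
    unfolding nxt_def by (rule someI_ex) (use l that in blast)
  define T where "T = (\<lambda>n. (nxt ^^ n) F)"
  show ?thesis
  proof (cases "\<exists>n. T n = 0")
    case True
    define m where "m = (LEAST n. T n = 0)"
    have Tm: "T m = 0"
      using True unfolding m_def by (rule LeastI_ex)
    have nonzero: "T n \<noteq> 0" if "n < m" for n
      using that not_less_Least unfolding m_def by blast
    have "T n = cf_step (l (T n)) (T (Suc n))" if "n < m" for n
      using F_eq[OF nonzero[OF that]] by (simp add: T_def)
    from foldr_cf_step_tails[of m T "\<lambda>n. l (T n)", OF this]
    have "F = finite_frac (map (\<lambda>n. l (T n)) [0..<m])"
      by (simp add: finite_frac_eq_foldr Tm) (simp add: T_def)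
    moreover have "\<forall>x \<in> set (map (\<lambda>n. l (T n)) [0..<m]). valid_level x"
      using l nonzero by auto
    ultimately show ?thesis
      by (intro exI[of _ "Terminating (map (\<lambda>n. l (T n)) [0..<m])"]) simp
  next
    case False
    then have "T n = cf_step (l (T n)) (T (Suc n))" for n
      using F_eq[of "T n"] by (simp add: T_def)
    from tails_tendsto[of T "\<lambda>n. l (T n)", OF this]
    have "(\<lambda>n. finite_frac (map (\<lambda>n. l (T n)) [0..<n])) \<longlonglongrightarrow> F"
      by (simp add: T_def)
    moreover have "\<forall>n. valid_level (l (T n))"
      using l False by blast
    ultimately show ?thesis
      by (intro exI[of _ "Infinite (\<lambda>n. l (T n))"]) simp
  qed
qed

text \<open>By the pigeonhole principle two tails \<open>T i\<close> and \<open>T j\<close>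
  coincide; injectivity of \<open>cf_step\<close> carries this over to all later tails and levels,
  giving the period \<open>j - i\<close>.\<close>

lemma periodic_if_finitely_many_tails:
  assumes valid: "\<And>n. valid_level (s n)"
    and T: "\<And>n. T n = cf_step (s n) (T (Suc n))"
    and fin: "finite (T ` {m..})"
  shows "ultimately_periodic (Infinite s)"
proof -
  have "\<not> inj_on T {m..}"
    using fin finite_image_iff infinite_Ici by blast
  then obtain i j where "i < j" "T i = T j"
    unfolding inj_on_def by (metis linorder_neq_iff)
  have *: "T (i + t) = T (j + t)" for t
  proof (induction t)
    case (Suc t)
    then show ?case
      using cf_step_inject[OF valid valid] T by (metis add_Suc_right)
  qed (use \<open>T i = T j\<close> in simp)
  have "s (i + t) = s (j + t)" for t
    using cf_step_inject[OF valid valid] T * by metis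
  from this[of "n - i" for n] have "s (n + (j - i)) = s n" if "n \<ge> i" for n
    using \<open>i < j\<close> that by (metis Nat.add_diff_assoc add.commute le_add_diff_inverse less_imp_le)
  then show ?thesis
    using \<open>i < j\<close> by (metis ultimately_periodic.simps(2) zero_less_diff)
qed

subsection \<open>Quadratic equations of bounded degree\<close>

text \<open>The last condition says that the derivative of \<open>A + B t + C t^2\<close> at
  \<open>t = F\<close> is a unit. The bound on \<open>A\<close> is strict because the next quadratic
  coefficient is \<open>x A\<close>.\<close>

definition simple_quadratic_root :: "nat \<Rightarrow> 'a::field fps \<Rightarrow> bool" where
  "simple_quadratic_root M F \<longleftrightarrow> (\<exists>A B C.
     fps_of_poly A + fps_of_poly B * F + fps_of_poly C * F\<^sup>2 = 0 \<and>
     degree A < M \<and> degree B \<le> M \<and> degree C \<le> M \<and>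
     poly B 0 + 2 * poly C 0 * F $ 0 \<noteq> 0)"

text \<open>The nonvanishing condition excludes \<open>B = C = 0\<close>, so only finitely many
  nonzero polynomials over the domain of power series occur, each with finitely many roots.\<close>

lemma finite_simple_quadratic_root:
  "finite {F :: 'a::{field, finite} fps. simple_quadratic_root M F}"
proof -
  let ?P = "{p :: 'a poly. degree p \<le> M}"
  let ?S = "(?P \<times> ?P \<times> ?P) \<inter> {(A, B, C). B \<noteq> 0 \<or> C \<noteq> 0}"
  let ?R = "\<lambda>(A, B, C). {F. poly [:fps_of_poly A, fps_of_poly B, fps_of_poly C:] F = 0}"
  have "finite ?S"
    by (intro finite_Int disjI1 finite_cartesian_product finite_poly_degree_le)
  moreover have "finite (?R x)" if "x \<in> ?S" for x
  proof -
    obtain A B C where x: "x = (A, B, C)" "B \<noteq> 0 \<or> C \<noteq> 0"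
      using \<open>x \<in> ?S\<close> by blast
    then have "[:fps_of_poly A, fps_of_poly B, fps_of_poly C:] \<noteq> 0"
      using fps_of_poly_eq_iff[of _ 0] by auto
    then show ?thesis
      unfolding x(1) prod.case by (rule poly_roots_finite)
  qed
  ultimately have "finite (\<Union>x \<in> ?S. ?R x)"
    by blast
  moreover have "{F. simple_quadratic_root M F} \<subseteq> (\<Union>x \<in> ?S. ?R x)"
  proof
    fix F :: "'a fps" assume "F \<in> {F. simple_quadratic_root M F}"
    then obtain A B C where
      "fps_of_poly A + fps_of_poly B * F + fps_of_poly C * F\<^sup>2 = 0"
      "degree A < M" "degree B \<le> M" "degree C \<le> M" "poly B 0 + 2 * poly C 0 * F $ 0 \<noteq> 0"
      by (auto simp: simple_quadratic_root_def)
    then have "(A, B, C) \<in> ?S" "F \<in> ?R (A, B, C)"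
      by (auto simp: algebra_simps power2_eq_square)
    then show "F \<in> (\<Union>x \<in> ?S. ?R x)"
      by blast
  qed
  ultimately show ?thesis
    by (rule rev_finite_subset)
qed

text \<open>Multiplying by the squared denominator replaces \<open>F\<close> by
  \<open>v x^k\<close>. As \<open>x^k\<close> divides \<open>A\<close>, all terms with
  \<open>G\<close> contain \<open>x^(2k+1)\<close>, so the rest does too. The second equation serves
  to bound the degree of \<open>A1\<close>.\<close>

lemma quadratic_cf_step:
  fixes A B C A' :: "'a::field poly"
  assumes eq: "fps_of_poly A + fps_of_poly B * F + fps_of_poly C * F\<^sup>2 = 0"
    and F: "F = cf_step (v, k, u) G"
    and A: "A = Polynomial.monom 1 k * A'"
  obtains A1 where
    "fps_of_poly A1 + fps_of_poly (- (2 * A' * pCons 1 u + Polynomial.smult v B)) * G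
       + fps_of_poly (Polynomial.monom 1 (k + 1) * A') * G\<^sup>2 = 0"
    "A * (pCons 1 u)\<^sup>2 + Polynomial.smult v (B * Polynomial.monom 1 k * pCons 1 u)
       + Polynomial.smult (v\<^sup>2) (C * Polynomial.monom 1 (2 * k)) = Polynomial.monom 1 (2 * k + 1) * A1"
proof -
  define D where "D = pCons 1 u"
  define a b c a' d V X Y where defs: "a = fps_of_poly A" "b = fps_of_poly B" "c = fps_of_poly C"
    "a' = fps_of_poly A'" "d = fps_of_poly D" "V = fps_const v" "X = (fps_X :: 'a fps)" "Y = X ^ k"
  have R: "denominator k u G = d - X * Y * G"
    by (simp add: defs denominator_def D_def fps_of_poly_pCons mult_ac)
  have FR: "F * (d - X * Y * G) = V * Y"
    using cf_step_mult_denominator[of v k u G] unfolding F R by (simp add: defs)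
  have a: "a = Y * a'"
    by (simp add: defs A fps_of_poly_mult fps_of_poly_monom')
  have "(a + b * F + c * F\<^sup>2) * (d - X * Y * G)\<^sup>2 = 0"
    using eq by (simp add: defs)
  \<comment> \<open>Stated for every \<open>R\<close>, so that \<open>F * R\<close> appears as a
    unit and \<open>FR\<close> can rewrite it.\<close>
  moreover have "(a + b * F + c * F\<^sup>2) * R\<^sup>2 = a * R\<^sup>2 + b * (F * R) * R + c * (F * R)\<^sup>2" for R
    by (simp add: algebra_simps power2_eq_square)
  ultimately have "a * (d - X * Y * G)\<^sup>2 + b * (V * Y) * (d - X * Y * G) + c * (V * Y)\<^sup>2 = 0"
    by (simp only: FR)
  then have main: "(a * d\<^sup>2 + V * (b * Y * d) + V\<^sup>2 * (c * Y\<^sup>2))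
      + X * Y\<^sup>2 * (- (2 * a' * d + V * b) * G + X * Y * a' * G\<^sup>2) = 0"
    by (simp add: a algebra_simps power2_eq_square)
  have X_power: "fps_X ^ (2 * k + 1) = X * Y\<^sup>2" "fps_X ^ (k + 1) = X * Y" "fps_X ^ (2 * k) = Y\<^sup>2"
    by (simp_all add: defs power_mult[symmetric] mult.commute)
  have "fps_of_poly (A * D\<^sup>2 + Polynomial.smult v (B * Polynomial.monom 1 k * D)
      + Polynomial.smult (v\<^sup>2) (C * Polynomial.monom 1 (2 * k)))
    + fps_X ^ (2 * k + 1) * (fps_of_poly (- (2 * A' * D + Polynomial.smult v B)) * G
      + fps_of_poly (Polynomial.monom 1 (k + 1) * A') * G\<^sup>2) = 0"
    using main unfolding fps_of_poly_simps fps_of_poly_monom' X_power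
    by (simp add: defs fps_const_power)
  then show thesis
    by (rule fps_of_poly_cancel_X_power) (rule that, auto simp: D_def add.assoc)
qed

lemma simple_quadratic_root_cf_step:
  fixes F :: "'a::field fps"
  assumes "simple_quadratic_root M F" and F_l: "F = cf_step l G" and valid: "valid_level l"
  shows "simple_quadratic_root M G"
proof -
  obtain v k u where l: "l = (v, k, u)"
    by (metis prod.exhaust)
  note F = F_l[unfolded l]
  from assms(1) obtain A B C where
    eq: "fps_of_poly A + fps_of_poly B * F + fps_of_poly C * F\<^sup>2 = 0"
    and deg: "degree A < M" "degree B \<le> M" "degree C \<le> M"
    and simple: "poly B 0 + 2 * poly C 0 * F $ 0 \<noteq> 0"
    by (auto simp: simple_quadratic_root_def)
  have v: "v \<noteq> 0" and u: "u = 0 \<or> degree u < k"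
    using valid by (auto simp: l valid_level_def)
  obtain W where W: "F = fps_X ^ k * W" "W $ 0 = v"
    unfolding F by (rule cf_step_eq_X_power_mult)
  have "fps_of_poly A + fps_X ^ k * (W * (fps_of_poly B + fps_of_poly C * F)) = 0"
    using eq by (simp add: W(1) algebra_simps power2_eq_square)
  then obtain A' where A: "A = Polynomial.monom 1 k * A'"
    and A': "fps_of_poly A' + W * (fps_of_poly B + fps_of_poly C * F) = 0"
    by (rule fps_of_poly_cancel_X_power)
  from arg_cong[OF A', of "\<lambda>f. f $ 0"]
  have A'0: "poly A' 0 = - v * (poly B 0 + poly C 0 * F $ 0)"
    by (simp add: W(2) poly_0_coeff_0 eq_neg_iff_add_eq_0)
  let ?D = "pCons 1 u"
  have D: "degree ?D \<le> k"
    using u by auto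
  obtain A1 where
    eq1: "fps_of_poly A1 + fps_of_poly (- (2 * A' * ?D + Polynomial.smult v B)) * G
       + fps_of_poly (Polynomial.monom 1 (k + 1) * A') * G\<^sup>2 = 0"
    and A1: "A * ?D\<^sup>2 + Polynomial.smult v (B * Polynomial.monom 1 k * ?D)
       + Polynomial.smult (v\<^sup>2) (C * Polynomial.monom 1 (2 * k)) = Polynomial.monom 1 (2 * k + 1) * A1"
    using quadratic_cf_step[OF eq F A] .
  have degA: "A' = 0 \<or> degree A = k + degree A'"
    by (cases "A' = 0") (auto simp: A degree_mult_eq degree_monom_eq monom_eq_0_iff)
  have degD2: "degree (?D\<^sup>2) \<le> 2 * k"
    using degree_power_le[of ?D 2] D by linarith
  show ?thesis
    unfolding simple_quadratic_root_def
  proof (intro exI conjI)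
    have "degree (A * ?D\<^sup>2) \<le> M + 2 * k"
      using degree_mult_le[of A "?D\<^sup>2"] deg(1) degD2 by linarith
    moreover have "degree (Polynomial.smult v (B * Polynomial.monom 1 k * ?D)) \<le> M + 2 * k"
      using degree_smult_le[of v "B * Polynomial.monom 1 k * ?D"]
        degree_mult_le[of "B * Polynomial.monom 1 k" ?D] degree_mult_le[of B "Polynomial.monom 1 k"]
        degree_monom_le[of "1 :: 'a" k] deg(2) D by linarith
    moreover have "degree (Polynomial.smult (v\<^sup>2) (C * Polynomial.monom 1 (2 * k))) \<le> M + 2 * k"
      using degree_smult_le[of "v\<^sup>2" "C * Polynomial.monom 1 (2 * k)"]
        degree_mult_le[of C "Polynomial.monom 1 (2 * k)"]
        degree_monom_le[of "1 :: 'a" "2 * k"] deg(3) by linarith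
    ultimately have "degree (Polynomial.monom 1 (2 * k + 1) * A1) \<le> M + 2 * k"
      unfolding A1[symmetric] by (intro degree_add_le)
    \<comment> \<open>Dividing by \<open>x^(2k+1)\<close> leaves degree at most
      \<open>M - 1\<close>; for \<open>A1 = 0\<close> the claim is \<open>0 < M\<close>, which
      \<open>degree A < M\<close> supplies.\<close>
    then show "degree A1 < M"
      using deg(1) by (cases "A1 = 0") (auto simp: degree_mult_eq degree_monom_eq)
    show "degree (- (2 * A' * ?D + Polynomial.smult v B)) \<le> M"
    proof -
      have "degree (2 * A' * ?D) \<le> M"
      proof (cases "A' = 0")
        case False
        then show ?thesis
          using degree_mult_le[of "2 * A'" ?D] degree_mult_le[of 2 A'] degA deg(1) D by simp
      qed simp
      moreover have "degree (Polynomial.smult v B) \<le> M"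
        using degree_smult_le[of v B] deg(2) by linarith
      ultimately show ?thesis
        unfolding degree_minus by (rule degree_add_le)
    qed
    show "degree (Polynomial.monom 1 (k + 1) * A') \<le> M"
      using degA deg(1) by (cases "A' = 0") (auto simp: degree_mult_eq degree_monom_eq monom_eq_0_iff)
    \<comment> \<open>Since \<open>D(0) = 1\<close>, the value \<open>A'0\<close> reproduces the old
      derivative up to the factor \<open>v\<close>; the coefficient of \<open>G^2\<close> vanishes
      at 0.\<close>
    have "poly (- (2 * A' * ?D + Polynomial.smult v B)) 0 = v * (poly B 0 + 2 * poly C 0 * F $ 0)"
      by (simp add: A'0 algebra_simps)
    then show "poly (- (2 * A' * ?D + Polynomial.smult v B)) 0
        + 2 * poly (Polynomial.monom 1 (k + 1) * A') 0 * G $ 0 \<noteq> 0"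
      using simple v by (simp add: poly_monom)
  qed (fact eq1)
qed

text \<open>For \<open>k > 0\<close> the derivative \<open>2 C F\<close> vanishes at 0. But
  \<open>A = - C F^2\<close> is divisible by \<open>x^(2k)\<close>, so the equation for
  \<open>G\<close> loses a further \<open>x^k\<close>, and its linear coefficient becomes
  \<open>2 C(0) v^2\<close> at 0.\<close>

lemma simple_quadratic_root_cf_step_pure:
  fixes F :: "'a::field fps"
  assumes eq: "fps_of_poly A + fps_of_poly C * F\<^sup>2 = 0"
    and F: "F = cf_step (v, k, u) G" and v: "v \<noteq> 0"
    and C: "poly C 0 \<noteq> 0" and two: "(2 :: 'a) \<noteq> 0"
  shows "\<exists>M. simple_quadratic_root M G"
proof -
  obtain W where W: "F = fps_X ^ k * W" "W $ 0 = v"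
    unfolding F by (rule cf_step_eq_X_power_mult)
  have "fps_of_poly A + fps_X ^ (2 * k) * (fps_of_poly C * W\<^sup>2) = 0"
    using eq by (simp add: W(1) power_mult_distrib power_mult[symmetric] mult_ac)
  then obtain A' where A: "A = Polynomial.monom 1 (2 * k) * A'"
    and A': "fps_of_poly A' + fps_of_poly C * W\<^sup>2 = 0"
    by (rule fps_of_poly_cancel_X_power)
  from arg_cong[OF A', of "\<lambda>f. f $ 0"]
  have A'0: "poly A' 0 = - poly C 0 * v\<^sup>2"
    by (simp add: W(2) poly_0_coeff_0 eq_neg_iff_add_eq_0 power2_eq_square)
  have A_split: "A = Polynomial.monom 1 k * (Polynomial.monom 1 k * A')"
    by (simp add: A mult.assoc[symmetric] mult_monom mult_2)
  have eq0: "fps_of_poly A + fps_of_poly 0 * F + fps_of_poly C * F\<^sup>2 = 0"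
    using eq by simp
  obtain A1 where
    "fps_of_poly A1 + fps_of_poly (- (2 * (Polynomial.monom 1 k * A') * pCons 1 u + Polynomial.smult v 0)) * G
       + fps_of_poly (Polynomial.monom 1 (k + 1) * (Polynomial.monom 1 k * A')) * G\<^sup>2 = 0"
    using quadratic_cf_step[OF eq0 F A_split] .
  then have "fps_of_poly A1 + fps_X ^ k * (fps_of_poly (- (2 * A' * pCons 1 u)) * G
      + fps_of_poly (Polynomial.monom 1 (k + 1) * A') * G\<^sup>2) = 0"
    by (simp add: fps_of_poly_mult fps_of_poly_uminus fps_of_poly_monom' algebra_simps
        del: mult_pCons_right mult_pCons_left)
  then obtain A2 where A2: "fps_of_poly A2 + (fps_of_poly (- (2 * A' * pCons 1 u)) * G
      + fps_of_poly (Polynomial.monom 1 (k + 1) * A') * G\<^sup>2) = 0"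
    by (rule fps_of_poly_cancel_X_power)
  let ?B = "- (2 * A' * pCons 1 u)" and ?C = "Polynomial.monom 1 (k + 1) * A'"
  have "poly ?B 0 + 2 * poly ?C 0 * G $ 0 \<noteq> 0"
    using v C two by (simp add: A'0 poly_monom)
  \<comment> \<open>Any common degree bound will do here; it only has to stay fixed for the later
    tails.\<close>
  then have "simple_quadratic_root (Suc (degree A2 + degree ?B + degree ?C)) G"
    unfolding simple_quadratic_root_def using A2
    by (intro exI[of _ A2] exI[of _ ?B] exI[of _ ?C]) (simp add: add.assoc del: degree_minus)
  then show ?thesis ..
qed

section \<open>The four cases of the theorem\<close>

lemma two_neq_0_mod_ring:
  assumes "CARD('p::prime_card) \<noteq> 2"
  shows "(2 :: 'p mod_ring) \<noteq> 0"
proof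
  assume "(2 :: 'p mod_ring) = 0"
  then have "of_nat 2 = (0 :: 'p mod_ring)"
    by simp
  then have "CARD('p) dvd 2"
    by (simp only: of_nat_0_mod_ring_dvd)
  then show False
    using assms prime_card[where 'a = 'p] by (metis primes_dvd_imp_eq two_is_prime_nat)
qed

theorem theorem3p5:
  fixes F :: "'p::prime_card mod_ring fps"
    and A B C :: "'p mod_ring poly"
  assumes "fps_of_poly A + fps_of_poly B * F + fps_of_poly C * F ^ 2 = 0"
    and "(poly B 0 = 1 \<and> poly C 0 = 0 \<and> C \<noteq> 0) \<or>
         (poly B 0 = 1 \<and> C = 0) \<or>
         (poly B 0 = 1 \<and> poly C 0 \<noteq> 0 \<and> poly A 0 = 0) \<or>
         (CARD('p) \<noteq> 2 \<and> B = 0 \<and> poly C 0 = 1 \<and>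
           (\<exists>k a. a \<noteq> 0 \<and> Polynomial.monom 1 (2 * k + 1) dvd A - (- (Polynomial.monom a k ^ 2))))"
  shows "(\<exists>E. super1_expansion F E) \<and>
         (\<forall>E. super1_expansion F E \<longrightarrow> ultimately_periodic E)"
proof (intro conjI allI impI)
  show "\<exists>E. super1_expansion F E"
    by (rule ex_super1_expansion)
next
  fix E assume E: "super1_expansion F E"
  show "ultimately_periodic E"
  proof (cases E)
    case (Infinite s)
    then have valid: "valid_level (s n)" for n
      using E by simp
    have "(\<lambda>n. finite_frac (map s [0..<n])) \<longlonglongrightarrow> F"
      using E Infinite by simp
    from ex_tails[OF this] obtain T
      where T: "T 0 = F" "\<And>n. T n = cf_step (s n) (T (Suc n))"
      by blast
    have step: "simple_quadratic_root M (T (Suc n))" if "simple_quadratic_root M (T n)" for M n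
      using simple_quadratic_root_cf_step[OF that T(2) valid] .
    \<comment> \<open>Index 1 covers all cases: in (iv) \<open>F\<close> itself may fail the
      nonvanishing condition.\<close>
    have "\<exists>M. simple_quadratic_root M (T 1)"
    proof (cases "poly B 0 = 1")
      case True
      have "poly A 0 + F $ 0 * (poly B 0 + poly C 0 * F $ 0) = 0"
        using arg_cong[OF assms(1), of "\<lambda>f. f $ 0"]
        by (simp add: poly_0_coeff_0 algebra_simps power2_eq_square)
      moreover have "poly A 0 * poly C 0 = 0"
        using assms(2) True by auto
      \<comment> \<open>Discriminant identity
        \<open>(B + 2CF)^2 = B^2 - 4AC + 4C(A + BF + CF^2)\<close> at \<open>x = 0\<close>;
        conditions (i)-(iii) all give \<open>A(0) C(0) = 0\<close>, so the square is 1.\<close>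
      moreover have "(1 + 2 * poly C 0 * F $ 0)\<^sup>2
          = 1 + 4 * poly C 0 * (poly A 0 + F $ 0 * (1 + poly C 0 * F $ 0)) - 4 * (poly A 0 * poly C 0)"
        by (simp add: algebra_simps power2_eq_square)
      ultimately have "(poly B 0 + 2 * poly C 0 * F $ 0)\<^sup>2 = 1"
        by (simp only: True mult_zero_right diff_zero add_0_right)
      then have "poly B 0 + 2 * poly C 0 * F $ 0 \<noteq> 0"
        by auto
      then have "simple_quadratic_root (Suc (degree A + degree B + degree C)) F"
        unfolding simple_quadratic_root_def using assms(1)
        by (intro exI[of _ A] exI[of _ B] exI[of _ C]) simp
      then show ?thesis
        using step[of _ 0] T(1) by auto
    next
      case False
      then have two: "(2 :: 'p mod_ring) \<noteq> 0" and B: "B = 0" and C: "poly C 0 \<noteq> 0"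
        using assms(2) two_neq_0_mod_ring by auto
      obtain v k u where s: "s 0 = (v, k, u)"
        by (metis prod.exhaust)
      show ?thesis
      proof (rule simple_quadratic_root_cf_step_pure)
        show "fps_of_poly A + fps_of_poly C * F\<^sup>2 = 0"
          using assms(1) B by simp
        show "F = cf_step (v, k, u) (T 1)"
          using T(1) T(2)[of 0] s by simp
        show "v \<noteq> 0"
          using valid[of 0] s by (simp add: valid_level_def)
      qed fact+
    qed
    then obtain M where M: "simple_quadratic_root M (T 1)" ..
    \<comment> \<open>The bound \<open>M\<close> is the same at every step, so all these tails lie
      in one finite set.\<close>
    have "simple_quadratic_root M (T (1 + n))" for n
      by (induction n) (use M step in auto)
    then have "T ` {1..} \<subseteq> {G. simple_quadratic_root M G}"
      by (auto simp: le_iff_add)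
    then have "finite (T ` {1..})"
      using finite_simple_quadratic_root finite_subset by blast
    then show ?thesis
      unfolding Infinite by (intro periodic_if_finitely_many_tails[of s T 1] valid T(2))
  qed simp
qed

end
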